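(* Let $t\ge 2$ and $N_x\ge 1$ be integers. With the state-space model, the particle filter sampling density $\psi_{t,\theta}$ and the likelihood estimator $\hat Z_t$ defined in the context, let $$\pi_t(\theta,x_{1:t}^{1:N_x},a_{1:t-1}^{1:N_x}) = p(\theta)\,\psi_{t,\theta}(x_{1:t}^{1:N_x},a_{1:t-1}^{1:N_x})\,\frac{\hat Z_t(\theta,x_{1:t}^{1:N_x},a_{1:t-1}^{1:N_x})}{p(y_{1:t})}.$$ Then $\pi_t$ may be written as $$\pi_t(\theta,x_{1:t}^{1:N_x},a_{1:t-1}^{1:N_x}) = p(\theta|y_{1:t})\times \frac{1}{N_x}\sum_{n=1}^{N_x}\frac{p(\mathbf{x}_{1:t}^n|\theta,y_{1:t})}{N_x^{t-1}}\left\{\prod_{\substack{i=1\\ i\ne \mathbf{h}_t^n(1)}}^{N_x} q_{1,\theta}(x_1^i)\right\}\left\{\prod_{s=2}^t\ \prod_{\substack{i=1\\ i\ne \mathbf{h}_t^n(s)}}^{N_x} W_{s-1,\theta}^{a_{s-1}^i}\, q_{s,\theta}(x_s^i|x_{s-1}^{a_{s-1}^i})\right\},$$ where $\mathbf{h}_t^n=(\mathbf{h}_t^n(1),\ldots,\mathbf{h}_t^n(t))$ and $\mathbf{x}_{1:t}^n=(\mathbf{x}_{1:t}^n(1),\ldots,\mathbf{x}_{1:t}^n(t))$ are the deterministic functions of $(x_{1:t}^{1:N_x},a_{1:t-1}^{1:N_x})$ defined by $\mathbf{h}_t^n(t)=n$, $\mathbf{h}_t^n(s)=a_s^{\mathbf{h}_t^n(s+1)}$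 recursively for $s=t-1,\ldots,1$, and $\mathbf{x}_{1:t}^n(s)=x_s^{\mathbf{h}_t^n(s)}$ for $s=1,\ldots,t$.
   Context: State-space model: parameter $\theta\in\Theta$ with prior density $p(\theta)$; latent Markov process $(x_t)$ with values in $\mathcal X$, initial density $p(x_1|\theta)=\mu_\theta(x_1)$ and transition density $f_\theta(x_{t+1}|x_t)$; observations $y_t$ which, given the states and $\theta$, are independent with density $g_\theta(y_t|x_t)$. The observations $y_{1:t}=(y_1,\dots,y_t)$ are fixed. All densities denoted by $p$ are those derived from the joint density $$p(\theta,x_{1:t},y_{1:t})=p(\theta)\,\mu_\theta(x_1)g_\theta(y_1|x_1)\prod_{s=2}^t f_\theta(x_s|x_{s-1})g_\theta(y_s|x_s);$$ e.g. $p(y_{1:t}|\theta)$ is the likelihood, $p(y_{1:t})=\int p(\theta)p(y_{1:t}|\theta)\,d\theta$ the evidence, $p(\theta|y_{1:t})$ the parameter posterior density, and $p(x_{1:t}|\theta,y_{1:t})$ the conditional density of the states. Particle filter. Let $q_{1,\theta}(x_1)$ and $q_{s,\theta}(x_s|x_{s-1})$, $s\ge2$, be proposal densities. For particles $x_s^n\in\mathcal X$ ($s\in 1:t$, $n\in 1:N_x$) and ancestor indices $a_s^n\in 1:N_x$ ($s\in 1:(t-1)$, $n\in 1:N_x$), the weights are $$w_{1,\theta}(x_1^n)=\frac{\mu_\theta(x_1^n)g_\theta(y_1|x_1^n)}{q_{1,\theta}(x_1^n)},\qquad w_{s,\theta}(x_{s-1}^{a_{s-1}^n},x_s^n)=\frac{f_\theta(x_s^n|x_{s-1}^{a_{s-1}^n})\,g_\theta(y_s|x_s^n)}{q_{s,\theta}(x_s^n|x_{s-1}^{a_{s-1}^n})}\quad(s\ge2),$$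 and the normalised weights are $$W_{1,\theta}^n=\frac{w_{1,\theta}(x_1^n)}{\sum_{i=1}^{N_x} w_{1,\theta}(x_1^i)},\qquad W_{s,\theta}^n=\frac{w_{s,\theta}(x_{s-1}^{a_{s-1}^n},x_s^n)}{\sum_{i=1}^{N_x} w_{s,\theta}(x_{s-1}^{a_{s-1}^i},x_s^i)}\quad(s\ge2).$$ The filter samples $x_1^n\sim q_{1,\theta}$ independently and then, for $s=2,\dots,t$ and each $n$ independently, draws $a_{s-1}^n$ equal to $k$ with probability $W_{s-1,\theta}^k$ and $x_s^n\sim q_{s,\theta}(\cdot|x_{s-1}^{a_{s-1}^n})$. The joint density of all the variables generated up to time $t$ is therefore $$\psi_{t,\theta}(x_{1:t}^{1:N_x},a_{1:t-1}^{1:N_x})=\left\{\prod_{n=1}^{N_x}q_{1,\theta}(x_1^n)\right\}\left\{\prod_{s=2}^t\prod_{n=1}^{N_x}W_{s-1,\theta}^{a_{s-1}^n}\,q_{s,\theta}(x_s^n|x_{s-1}^{a_{s-1}^n})\right\}.$$ The likelihood estimator is $$\hat Z_t(\theta,x_{1:t}^{1:N_x},a_{1:t-1}^{1:N_x})=\left(\frac1{N_x}\right)^t\left\{\sum_{n=1}^{N_x}w_{1,\theta}(x_1^n)\right\}\prod_{s=2}^t\left\{\sum_{n=1}^{N_x}w_{s,\theta}(x_{s-1}^{a_{s-1}^n},x_s^n)\right\}.$$ Notation: $x_{1:t}^{1:N_x}$ is the collection of all $x_s^n$, $s\in 1:t$, $n\in 1:N_x$, and similarly for $a_{1:t-1}^{1:N_x}$.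 The identity between densities is understood at points where all quotients involved (weights, normalised weights, conditional densities) have non-zero denominators. *)

theory Defs
  imports "HOL-Analysis.Analysis"
begin

definition prob_density :: "'b measure \<Rightarrow> ('b \<Rightarrow> real) \<Rightarrow> bool" where
  "prob_density B h \<longleftrightarrow>
     h \<in> borel_measurable B \<and> (\<forall>b\<in>space B. 0 \<le> h b) \<and> (\<integral>\<^sup>+ b. ennreal (h b) \<partial>B) = 1"

(* Conditional density, with respect to B, of an outcome b given a: the conditioning
   argument always comes first, so k a b stands for k(b | a). *)
definition cond_density :: "'a measure \<Rightarrow> 'b measure \<Rightarrow> ('a \<Rightarrow> 'b \<Rightarrow> real) \<Rightarrow> bool" where
  "cond_density A B k \<longleftrightarrow>
     (\<lambda>(a, b). k a b) \<in> borel_measurable (A \<Otimes>\<^sub>M B) \<and> (\<forall>a\<in>space A. prob_density B (k a))"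

(* The three measures are the reference measures with respect to which the densities are taken.
   init M \<theta> x = \<mu>\<^sub>\<theta>(x),  trans M \<theta> x x' = f\<^sub>\<theta>(x' | x),  obs M \<theta> x y = g\<^sub>\<theta>(y | x). *)
record ('p, 'x, 'y) ssm =
  params :: "'p measure"
  states :: "'x measure"
  observations :: "'y measure"
  prior :: "'p \<Rightarrow> real"
  init :: "'p \<Rightarrow> 'x \<Rightarrow> real"
  trans :: "'p \<Rightarrow> 'x \<Rightarrow> 'x \<Rightarrow> real"
  obs :: "'p \<Rightarrow> 'x \<Rightarrow> 'y \<Rightarrow> real"

definition state_space_model :: "('p, 'x, 'y) ssm \<Rightarrow> bool" where
  "state_space_model M \<longleftrightarrow>
     sigma_finite_measure (params M) \<and> sigma_finite_measure (states M) \<and>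
     sigma_finite_measure (observations M) \<and>
     prob_density (params M) (prior M) \<and>
     cond_density (params M) (states M) (init M) \<and>
     cond_density (params M \<Otimes>\<^sub>M states M) (states M) (\<lambda>(\<theta>, x). trans M \<theta> x) \<and>
     cond_density (params M \<Otimes>\<^sub>M states M) (observations M) (\<lambda>(\<theta>, x). obs M \<theta> x)"

(* q1 \<theta> x = q\<^sub>1\<^sub>,\<^sub>\<theta>(x) and, for s \<ge> 2, q s \<theta> x x' = q\<^sub>s\<^sub>,\<^sub>\<theta>(x' | x). *)
definition proposals ::
  "('p, 'x, 'y) ssm \<Rightarrow> ('p \<Rightarrow> 'x \<Rightarrow> real) \<Rightarrow> (nat \<Rightarrow> 'p \<Rightarrow> 'x \<Rightarrow> 'x \<Rightarrow> real) \<Rightarrow> bool" where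
  "proposals M q1 q \<longleftrightarrow>
     cond_density (params M) (states M) q1 \<and>
     (\<forall>s\<ge>2. cond_density (params M \<Otimes>\<^sub>M states M) (states M) (\<lambda>(\<theta>, x). q s \<theta> x))"

text \<open>
  A state path \<open>x\<^sub>1\<^sub>:\<^sub>t\<close> is a function on \<open>nat\<close> of which only the values at \<open>1, \<dots>, t\<close> matter,
  and likewise for the observations. Marginals are Bochner integrals, which are \<open>0\<close> when the
  integrand is not integrable; hence a non-zero value comes from an integrable integrand.
\<close>

(* p(\<theta>, x\<^sub>1\<^sub>:\<^sub>t, y\<^sub>1\<^sub>:\<^sub>t) *)
definition joint_dens ::
  "('p, 'x, 'y) ssm \<Rightarrow> (nat \<Rightarrow> 'y) \<Rightarrow> nat \<Rightarrow> 'p \<Rightarrow> (nat \<Rightarrow> 'x) \<Rightarrow> real" where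
  "joint_dens M y t \<theta> x =
     prior M \<theta> * init M \<theta> (x 1) * obs M \<theta> (x 1) (y 1) *
     (\<Prod>s\<in>{2..t}. trans M \<theta> (x (s - 1)) (x s) * obs M \<theta> (x s) (y s))"

(* p(\<theta>, y\<^sub>1\<^sub>:\<^sub>t) *)
definition param_obs_dens :: "('p, 'x, 'y) ssm \<Rightarrow> (nat \<Rightarrow> 'y) \<Rightarrow> nat \<Rightarrow> 'p \<Rightarrow> real" where
  "param_obs_dens M y t \<theta> = (\<integral> x. joint_dens M y t \<theta> x \<partial>(\<Pi>\<^sub>M s\<in>{1..t}. states M))"

(* p(y\<^sub>1\<^sub>:\<^sub>t | \<theta>); where p(\<theta>) = 0 the value is 0, which does not affect the evidence. *)
definition likelihood :: "('p, 'x, 'y) ssm \<Rightarrow> (nat \<Rightarrow> 'y) \<Rightarrow> nat \<Rightarrow> 'p \<Rightarrow> real" where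
  "likelihood M y t \<theta> = param_obs_dens M y t \<theta> / prior M \<theta>"

(* p(y\<^sub>1\<^sub>:\<^sub>t) *)
definition evidence :: "('p, 'x, 'y) ssm \<Rightarrow> (nat \<Rightarrow> 'y) \<Rightarrow> nat \<Rightarrow> real" where
  "evidence M y t = (\<integral> \<theta>. prior M \<theta> * likelihood M y t \<theta> \<partial>params M)"

(* p(\<theta> | y\<^sub>1\<^sub>:\<^sub>t) *)
definition param_posterior :: "('p, 'x, 'y) ssm \<Rightarrow> (nat \<Rightarrow> 'y) \<Rightarrow> nat \<Rightarrow> 'p \<Rightarrow> real" where
  "param_posterior M y t \<theta> = param_obs_dens M y t \<theta> / evidence M y t"

(* p(x\<^sub>1\<^sub>:\<^sub>t | \<theta>, y\<^sub>1\<^sub>:\<^sub>t) *)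
definition smoothing_dens ::
  "('p, 'x, 'y) ssm \<Rightarrow> (nat \<Rightarrow> 'y) \<Rightarrow> nat \<Rightarrow> 'p \<Rightarrow> (nat \<Rightarrow> 'x) \<Rightarrow> real" where
  "smoothing_dens M y t \<theta> x = joint_dens M y t \<theta> x / param_obs_dens M y t \<theta>"

text \<open>
  The particle \<open>x\<^sub>s\<^sup>n\<close> is \<open>x s n\<close> and the ancestor index \<open>a\<^sub>s\<^sup>n\<close> is \<open>a s n\<close>, with times and
  particle labels starting at \<open>1\<close>.
\<close>

definition weight ::
  "('p, 'x, 'y) ssm \<Rightarrow> ('p \<Rightarrow> 'x \<Rightarrow> real) \<Rightarrow> (nat \<Rightarrow> 'p \<Rightarrow> 'x \<Rightarrow> 'x \<Rightarrow> real) \<Rightarrow> (nat \<Rightarrow> 'y) \<Rightarrow>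
   'p \<Rightarrow> (nat \<Rightarrow> nat \<Rightarrow> 'x) \<Rightarrow> (nat \<Rightarrow> nat \<Rightarrow> nat) \<Rightarrow> nat \<Rightarrow> nat \<Rightarrow> real" where
  "weight M q1 q y \<theta> x a s n =
     (if s = 1 then init M \<theta> (x 1 n) * obs M \<theta> (x 1 n) (y 1) / q1 \<theta> (x 1 n)
      else trans M \<theta> (x (s - 1) (a (s - 1) n)) (x s n) * obs M \<theta> (x s n) (y s)
             / q s \<theta> (x (s - 1) (a (s - 1) n)) (x s n))"

definition norm_weight ::
  "('p, 'x, 'y) ssm \<Rightarrow> ('p \<Rightarrow> 'x \<Rightarrow> real) \<Rightarrow> (nat \<Rightarrow> 'p \<Rightarrow> 'x \<Rightarrow> 'x \<Rightarrow> real) \<Rightarrow> (nat \<Rightarrow> 'y) \<Rightarrow>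
   nat \<Rightarrow> 'p \<Rightarrow> (nat \<Rightarrow> nat \<Rightarrow> 'x) \<Rightarrow> (nat \<Rightarrow> nat \<Rightarrow> nat) \<Rightarrow> nat \<Rightarrow> nat \<Rightarrow> real" where
  "norm_weight M q1 q y N \<theta> x a s n =
     weight M q1 q y \<theta> x a s n / (\<Sum>i\<in>{1..N}. weight M q1 q y \<theta> x a s i)"

(* \<psi>\<^sub>t\<^sub>,\<^sub>\<theta> *)
definition filter_dens ::
  "('p, 'x, 'y) ssm \<Rightarrow> ('p \<Rightarrow> 'x \<Rightarrow> real) \<Rightarrow> (nat \<Rightarrow> 'p \<Rightarrow> 'x \<Rightarrow> 'x \<Rightarrow> real) \<Rightarrow> (nat \<Rightarrow> 'y) \<Rightarrow>
   nat \<Rightarrow> nat \<Rightarrow> 'p \<Rightarrow> (nat \<Rightarrow> nat \<Rightarrow> 'x) \<Rightarrow> (nat \<Rightarrow> nat \<Rightarrow> nat) \<Rightarrow> real" where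
  "filter_dens M q1 q y N t \<theta> x a =
     (\<Prod>n\<in>{1..N}. q1 \<theta> (x 1 n)) *
     (\<Prod>s\<in>{2..t}. \<Prod>n\<in>{1..N}. norm_weight M q1 q y N \<theta> x a (s - 1) (a (s - 1) n) *
        q s \<theta> (x (s - 1) (a (s - 1) n)) (x s n))"

definition likelihood_est ::
  "('p, 'x, 'y) ssm \<Rightarrow> ('p \<Rightarrow> 'x \<Rightarrow> real) \<Rightarrow> (nat \<Rightarrow> 'p \<Rightarrow> 'x \<Rightarrow> 'x \<Rightarrow> real) \<Rightarrow> (nat \<Rightarrow> 'y) \<Rightarrow>
   nat \<Rightarrow> nat \<Rightarrow> 'p \<Rightarrow> (nat \<Rightarrow> nat \<Rightarrow> 'x) \<Rightarrow> (nat \<Rightarrow> nat \<Rightarrow> nat) \<Rightarrow> real" where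
  "likelihood_est M q1 q y N t \<theta> x a =
     (1 / real N) ^ t * (\<Sum>n\<in>{1..N}. weight M q1 q y \<theta> x a 1 n) *
     (\<Prod>s\<in>{2..t}. \<Sum>n\<in>{1..N}. weight M q1 q y \<theta> x a s n)"

(* \<pi>\<^sub>t *)
definition extended_target ::
  "('p, 'x, 'y) ssm \<Rightarrow> ('p \<Rightarrow> 'x \<Rightarrow> real) \<Rightarrow> (nat \<Rightarrow> 'p \<Rightarrow> 'x \<Rightarrow> 'x \<Rightarrow> real) \<Rightarrow> (nat \<Rightarrow> 'y) \<Rightarrow>
   nat \<Rightarrow> nat \<Rightarrow> 'p \<Rightarrow> (nat \<Rightarrow> nat \<Rightarrow> 'x) \<Rightarrow> (nat \<Rightarrow> nat \<Rightarrow> nat) \<Rightarrow> real" where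
  "extended_target M q1 q y N t \<theta> x a =
     prior M \<theta> * filter_dens M q1 q y N t \<theta> x a *
     (likelihood_est M q1 q y N t \<theta> x a / evidence M y t)"

(* lineage a t n s is the label at time s \<le> t of the ancestor of particle n of time t. *)
function lineage :: "(nat \<Rightarrow> nat \<Rightarrow> nat) \<Rightarrow> nat \<Rightarrow> nat \<Rightarrow> nat \<Rightarrow> nat" where
  "lineage a t n s = (if s < t then a s (lineage a t n (s + 1)) else n)"
  by auto
termination by (relation "Wellfounded.measure (\<lambda>(a, t, n, s). t - s)") auto

declare lineage.simps [simp del]

definition trajectory ::
  "(nat \<Rightarrow> nat \<Rightarrow> 'x) \<Rightarrow> (nat \<Rightarrow> nat \<Rightarrow> nat) \<Rightarrow> nat \<Rightarrow> nat \<Rightarrow> nat \<Rightarrow> 'x" where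
  "trajectory x a t n s = x s (lineage a t n s)"

end

theory Submission
  imports Defs
begin

text \<open>
  In the product of \<open>\<psi>\<close> with the sums of weights, every normalising sum of times \<open>1, \<dots>, t - 1\<close>
  cancels against the denominators of the normalised weights along any one lineage. The sum of
  time \<open>t\<close> remains and is expanded over its particle \<open>n\<close>; in its summand, the factors of
  \<open>\<psi>\<close> along the lineage of \<open>n\<close> turn the weights there into \<open>\<mu>\<^sub>\<theta>\<close>, \<open>f\<^sub>\<theta>\<close> and \<open>g\<^sub>\<theta>\<close>, that is,
  into the joint density of the trajectory of \<open>n\<close>.
\<close>

lemma lineage_final: "lineage a t n t = n"
  by (simp add: lineage.simps)

lemma lineage_pred:
  assumes "s \<in> {2..t}"
  shows "lineage a t n (s - 1) = a (s - 1) (lineage a t n s)"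
  using assms by (subst lineage.simps) auto

text \<open>The induction runs backwards in time, on \<open>t - s\<close>, since a lineage is
  followed from time \<open>t\<close> down. The bound is what allows the factor of a lineage to be
  split off a product over \<open>{1..N}\<close>.\<close>

lemma lineage_in_range:
  assumes "\<forall>s\<in>{1..t - 1}. \<forall>n\<in>{1..N}. a s n \<in> {1..N}" and "n \<in> {1..N}" and "s \<in> {1..t}"
  shows "lineage a t n s \<in> {1..N}"
  using assms(3)
proof (induction "t - s" arbitrary: s)
  case 0
  then show ?case using assms(2) lineage_final[of a t n] by simp
next
  case (Suc k)
  then have s: "s \<in> {1..t - 1}" "s + 1 \<in> {2..t}" and "lineage a t n (s + 1) \<in> {1..N}"
    using Suc.hyps(1)[of "s + 1"] by auto
  moreover have "lineage a t n s = a s (lineage a t n (s + 1))"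
    using lineage_pred[OF s(2), of a n] by simp
  ultimately show ?case using assms(1) by metis
qed

text \<open>Both sides are the product of \<open>F\<close> over \<open>{1..t}\<close>. The shift
  matches the lag in \<psi>, whose factor at \<open>s\<close> holds a normalised weight of time
  \<open>s - 1\<close>; it is applied to the weights along a lineage and to the sums of
  weights.\<close>

lemma prod_shift_pred:
  fixes F :: "nat \<Rightarrow> 'a :: comm_monoid_mult"
  assumes "t \<ge> 1"
  shows "F 1 * (\<Prod>s\<in>{2..t}. F s) = (\<Prod>s\<in>{2..t}. F (s - 1)) * F t"
  using assms
proof (induction t rule: dec_induct)
  case base
  then show ?case by simp
next
  case (step m)
  then have "{2..Suc m} = insert (Suc m) {2..m}" by auto
  then have "F 1 * (\<Prod>s\<in>{2..Suc m}. F s) = F (Suc m) * (F 1 * (\<Prod>s\<in>{2..m}. F s))"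
    by (simp add: ac_simps)
  with step.IH \<open>{2..Suc m} = insert (Suc m) {2..m}\<close> show ?case by (simp add: ac_simps)
qed

text \<open>A weight times its proposal density is the numerator of the weight, and along a lineage
  these numerators multiply up to the joint density. Shifting the weights by one time step then
  pairs them with the proposals as in \<psi> and leaves the weight of time \<open>t\<close>
  over.\<close>

lemma joint_dens_trajectory:
  assumes "t \<ge> 1"
    and q1: "q1 \<theta> (x 1 (lineage a t n 1)) \<noteq> 0"
    and q: "\<And>s. s \<in> {2..t} \<Longrightarrow>
      q s \<theta> (x (s - 1) (a (s - 1) (lineage a t n s))) (x s (lineage a t n s)) \<noteq> 0"
  shows "joint_dens M y t \<theta> (trajectory x a t n) =
    prior M \<theta> * q1 \<theta> (x 1 (lineage a t n 1)) * weight M q1 q y \<theta> x a t n *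
    (\<Prod>s\<in>{2..t}. weight M q1 q y \<theta> x a (s - 1) (lineage a t n (s - 1)) *
       q s \<theta> (x (s - 1) (a (s - 1) (lineage a t n s))) (x s (lineage a t n s)))"
proof -
  define h where "h = lineage a t n"
  define w where "w s = weight M q1 q y \<theta> x a s (h s)" for s
  define r where "r s = q s \<theta> (x (s - 1) (a (s - 1) (h s))) (x s (h s))" for s
  have w1: "init M \<theta> (x 1 (h 1)) * obs M \<theta> (x 1 (h 1)) (y 1) = q1 \<theta> (x 1 (h 1)) * w 1"
    using q1 by (simp add: w_def h_def weight_def)
  \<comment> \<open>The weight of \<open>h s\<close> refers to the previous state by the label
    \<open>a (s - 1) (h s)\<close>, which \<open>lineage_pred\<close> identifies with
    \<open>h (s - 1)\<close>.\<close>
  have ws: "trans M \<theta> (x (s - 1) (h (s - 1))) (x s (h s)) * obs M \<theta> (x s (h s)) (y s) = w s * r s"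
    if "s \<in> {2..t}" for s
    using q[OF that] that lineage_pred[OF that, of a n] by (simp add: w_def r_def h_def weight_def)
  have "joint_dens M y t \<theta> (trajectory x a t n) =
      prior M \<theta> * (init M \<theta> (x 1 (h 1)) * obs M \<theta> (x 1 (h 1)) (y 1)) *
      (\<Prod>s\<in>{2..t}. trans M \<theta> (x (s - 1) (h (s - 1))) (x s (h s)) * obs M \<theta> (x s (h s)) (y s))"
    by (simp add: joint_dens_def trajectory_def h_def mult.assoc)
  also have "\<dots> = prior M \<theta> * (q1 \<theta> (x 1 (h 1)) * w 1) * (\<Prod>s\<in>{2..t}. w s * r s)"
    by (simp only: w1 ws cong: prod.cong)
  also have "\<dots> = prior M \<theta> * q1 \<theta> (x 1 (h 1)) * (w 1 * (\<Prod>s\<in>{2..t}. w s)) * (\<Prod>s\<in>{2..t}. r s)"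
    by (simp add: prod.distrib mult.assoc)
  also have "\<dots> = prior M \<theta> * q1 \<theta> (x 1 (h 1)) * w t * (\<Prod>s\<in>{2..t}. w (s - 1) * r s)"
    unfolding prod_shift_pred[OF \<open>t \<ge> 1\<close>] by (simp add: prod.distrib ac_simps)
  finally show ?thesis
    by (simp add: w_def r_def h_def lineage_final)
qed

theorem proposition1:
  fixes M :: "('p, 'x, 'y) ssm"
    and q1 :: "'p \<Rightarrow> 'x \<Rightarrow> real" and q :: "nat \<Rightarrow> 'p \<Rightarrow> 'x \<Rightarrow> 'x \<Rightarrow> real"
    and y :: "nat \<Rightarrow> 'y" and t N :: nat and \<theta> :: 'p
    and x :: "nat \<Rightarrow> nat \<Rightarrow> 'x" and a :: "nat \<Rightarrow> nat \<Rightarrow> nat"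
  assumes "state_space_model M" and "proposals M q1 q"
    and "t \<ge> 2" and "N \<ge> 1"
    and "\<forall>s\<in>{1..t}. y s \<in> space (observations M)"
    and "\<theta> \<in> space (params M)"
    and "\<forall>s\<in>{1..t}. \<forall>n\<in>{1..N}. x s n \<in> space (states M)"
    and "\<forall>s\<in>{1..t - 1}. \<forall>n\<in>{1..N}. a s n \<in> {1..N}"
    and "evidence M y t \<noteq> 0" and "param_obs_dens M y t \<theta> \<noteq> 0"
    and "\<forall>n\<in>{1..N}. q1 \<theta> (x 1 n) \<noteq> 0"
    and "\<forall>s\<in>{2..t}. \<forall>n\<in>{1..N}. q s \<theta> (x (s - 1) (a (s - 1) n)) (x s n) \<noteq> 0"
    and "\<forall>s\<in>{1..t - 1}. (\<Sum>i\<in>{1..N}. weight M q1 q y \<theta> x a s i) \<noteq> 0"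
  shows "extended_target M q1 q y N t \<theta> x a =
    param_posterior M y t \<theta> *
    (1 / real N * (\<Sum>n\<in>{1..N}.
       smoothing_dens M y t \<theta> (trajectory x a t n) / real N ^ (t - 1) *
       (\<Prod>i\<in>{1..N} - {lineage a t n 1}. q1 \<theta> (x 1 i)) *
       (\<Prod>s\<in>{2..t}. \<Prod>i\<in>{1..N} - {lineage a t n s}.
          norm_weight M q1 q y N \<theta> x a (s - 1) (a (s - 1) i) *
          q s \<theta> (x (s - 1) (a (s - 1) i)) (x s i))))"
proof -
  define w where "w = weight M q1 q y \<theta> x a"
  define S where "S s = (\<Sum>i\<in>{1..N}. w s i)" for s
  define r where "r s i = q s \<theta> (x (s - 1) (a (s - 1) i)) (x s i)" for s i
  define G where "G s i = norm_weight M q1 q y N \<theta> x a (s - 1) (a (s - 1) i) * r s i" for s i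
  define h where "h = lineage a t"
  define J where "J n = joint_dens M y t \<theta> (trajectory x a t n)" for n
  \<comment> \<open>What remains of \<psi> once the factors along the lineage of \<open>n\<close>
    are removed.\<close>
  define R where "R n = (\<Prod>i\<in>{1..N} - {h n 1}. q1 \<theta> (x 1 i)) *
    (\<Prod>s\<in>{2..t}. \<Prod>i\<in>{1..N} - {h n s}. G s i)" for n
  have t: "t \<ge> 1" using \<open>t \<ge> 2\<close> by simp
  have h_range: "h n s \<in> {1..N}" if "n \<in> {1..N}" "s \<in> {1..t}" for n s
    using lineage_in_range[OF assms(8) that] by (simp add: h_def)
  have S_nz: "S (s - 1) \<noteq> 0" if "s \<in> {2..t}" for s
  proof -
    have "s - 1 \<in> {1..t - 1}" using that by auto
    with assms(13) show ?thesis unfolding S_def w_def by blast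
  qed
  have r_nz: "r s i \<noteq> 0" if "s \<in> {2..t}" "i \<in> {1..N}" for s i
    using assms(12) that by (simp add: r_def)

  have summand: "prior M \<theta> * filter_dens M q1 q y N t \<theta> x a * (\<Prod>s\<in>{2..t}. S (s - 1)) * w t n =
      J n * R n" if n: "n \<in> {1..N}" for n
  proof -
    have h1: "h n 1 \<in> {1..N}" using h_range[OF n] t by simp
    have "S (s - 1) * (\<Prod>i\<in>{1..N}. G s i) =
        w (s - 1) (h n (s - 1)) * r s (h n s) * (\<Prod>i\<in>{1..N} - {h n s}. G s i)"
      if s: "s \<in> {2..t}" for s
    proof -
      have "h n s \<in> {1..N}" using h_range[OF n] s by simp
      then have "(\<Prod>i\<in>{1..N}. G s i) = G s (h n s) * (\<Prod>i\<in>{1..N} - {h n s}. G s i)"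
        by (simp add: prod.remove)
      \<comment> \<open>The normalised weight in \<open>G s (h n s)\<close> is that of the ancestor
        \<open>h n (s - 1)\<close>, with denominator \<open>S (s - 1)\<close>.\<close>
      moreover have "S (s - 1) * G s (h n s) = w (s - 1) (h n (s - 1)) * r s (h n s)"
        using S_nz[OF s] lineage_pred[OF s, of a n]
        by (simp add: G_def norm_weight_def h_def w_def S_def)
      ultimately show ?thesis by (metis mult.assoc)
    qed
    then have "(\<Prod>s\<in>{2..t}. S (s - 1)) * (\<Prod>s\<in>{2..t}. \<Prod>i\<in>{1..N}. G s i) =
        (\<Prod>s\<in>{2..t}. w (s - 1) (h n (s - 1)) * r s (h n s)) *
        (\<Prod>s\<in>{2..t}. \<Prod>i\<in>{1..N} - {h n s}. G s i)"
      by (simp only: prod.distrib[symmetric] cong: prod.cong)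
    moreover have "filter_dens M q1 q y N t \<theta> x a = q1 \<theta> (x 1 (h n 1)) *
        (\<Prod>i\<in>{1..N} - {h n 1}. q1 \<theta> (x 1 i)) * (\<Prod>s\<in>{2..t}. \<Prod>i\<in>{1..N}. G s i)"
      unfolding filter_dens_def G_def r_def using h1 by (simp add: prod.remove)
    moreover have "J n = prior M \<theta> * q1 \<theta> (x 1 (h n 1)) * w t n *
        (\<Prod>s\<in>{2..t}. w (s - 1) (h n (s - 1)) * r s (h n s))"
      unfolding J_def w_def r_def h_def
    proof (rule joint_dens_trajectory[OF t])
      show "q1 \<theta> (x 1 (lineage a t n 1)) \<noteq> 0"
        using assms(11) h1 by (simp add: h_def)
    next
      fix s assume s: "s \<in> {2..t}"
      with h_range[OF n, of s] r_nz[of s "h n s"]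
      show "q s \<theta> (x (s - 1) (a (s - 1) (lineage a t n s))) (x s (lineage a t n s)) \<noteq> 0"
        by (simp add: r_def h_def)
    qed
    ultimately show ?thesis by (simp add: R_def ac_simps)
  qed

  \<comment> \<open>This isolates \<open>S t\<close>, the one sum that is no denominator in \<psi>;
    expanding it produces the sum over \<open>n\<close>.\<close>
  have "S 1 * (\<Prod>s\<in>{2..t}. S s) = (\<Prod>s\<in>{2..t}. S (s - 1)) * (\<Sum>n\<in>{1..N}. w t n)"
    unfolding prod_shift_pred[OF t] by (simp add: S_def)
  then have "likelihood_est M q1 q y N t \<theta> x a =
      (1 / real N) ^ t * ((\<Prod>s\<in>{2..t}. S (s - 1)) * (\<Sum>n\<in>{1..N}. w t n))"
    by (simp only: likelihood_est_def S_def w_def mult.assoc)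
  then have "extended_target M q1 q y N t \<theta> x a =
      (1 / real N) ^ t / evidence M y t *
      (\<Sum>n\<in>{1..N}. prior M \<theta> * filter_dens M q1 q y N t \<theta> x a * (\<Prod>s\<in>{2..t}. S (s - 1)) * w t n)"
    by (simp add: extended_target_def sum_distrib_left[symmetric] mult.assoc)
  also have "\<dots> = (1 / real N) ^ t / evidence M y t * (\<Sum>n\<in>{1..N}. J n * R n)"
    using summand by simp
  \<comment> \<open>One factor gives the average over \<open>n\<close>; the other
    \<open>t - 1\<close> go into the summands.\<close>
  also have "(1 / real N) ^ t = 1 / real N * (1 / real N ^ (t - 1))"
    using t by (cases t) (simp_all add: power_divide)
  \<comment> \<open>Multiplying and dividing by \<open>param_obs_dens M y t \<theta>\<close> splits
    the joint density over the evidence into the parameter posterior and the smoothing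
    density.\<close>
  also have "1 / real N * (1 / real N ^ (t - 1)) / evidence M y t * (\<Sum>n\<in>{1..N}. J n * R n) =
      param_posterior M y t \<theta> *
      (1 / real N * (\<Sum>n\<in>{1..N}. J n / param_obs_dens M y t \<theta> / real N ^ (t - 1) * R n))"
    using assms(10) by (simp add: param_posterior_def sum_divide_distrib[symmetric])
  finally show ?thesis
    by (simp add: J_def R_def G_def r_def h_def smoothing_dens_def mult.assoc)
qed

end
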